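(* Let $s\in\{2,3,\dots\}$ and $p\in(0,1)$ be fixed, let $\alpha>0$, and let $X_1,X_2,\dots$ be independent random variables, each with the Hill-horror distribution $HH(\alpha)$, with quantile function $F_X^\leftarrow$. For $i\in\mathbb{N}$, $i\ge 1$, put $n=i(s+1)-1$, let $X_{(1,n)}\le\dots\le X_{(n,n)}$ be the order statistics of $X_1,\dots,X_n$, and define $$Q_{i,s}^{HH*}=\frac{\log\frac{X_{(is,n)}}{X_{(i,n)}}+\log\left[1-\frac{\log(s)}{\log(s+1)}\right]}{\log(s)},\qquad \left(\hat F_{i,s,HH}^\leftarrow\right)^*(p)=\frac{-\log(1-p)}{(1-p)^{Q_{i,s}^{HH*}}}.$$ Then, as $i\to\infty$: (i) $Q_{i,s}^{HH*}\to\frac1\alpha$ almost surely; (ii) $\left(\hat F_{i,s,HH}^\leftarrow\right)^*(p)\to F_X^\leftarrow(p)$ almost surely.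
   Context: For $\alpha>0$, the Hill-horror distribution $HH(\alpha)$ is the probability distribution on $(0,\infty)$ whose quantile function is $F_X^\leftarrow(p)=\frac{-\log(1-p)}{(1-p)^{1/\alpha}}$, $p\in(0,1)$, where the quantile function of a c.d.f. $F$ is $F^\leftarrow(p)=\inf\{x\in\mathbb{R}:F(x)\ge p\}$. The order statistics $X_{(1,n)}\le\dots\le X_{(n,n)}$ are the sample values arranged in increasing order. *)

theory Defs
  imports "HOL-Probability.Probability"
begin

text \<open>
  For a cdf \<open>F\<close> and \<open>0 < p < 1\<close> the set below is nonempty and bounded below, so the
  infimum in the conditionally complete lattice of reals is the intended one.
\<close>

definition quantile :: "(real \<Rightarrow> real) \<Rightarrow> real \<Rightarrow> real" where
  "quantile F p = Inf {x. F x \<ge> p}"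

text \<open>
  The expression \<open>-log(1-p) / (1-p)^\<gamma>\<close> is used both with \<open>\<gamma> = 1/\<alpha>\<close> (the true quantile function)
  and with \<open>\<gamma>\<close> replaced by an estimator.
\<close>

definition hh_quantile :: "real \<Rightarrow> real \<Rightarrow> real" where
  "hh_quantile \<gamma> p = - ln (1 - p) / (1 - p) powr \<gamma>"

definition hill_horror :: "real \<Rightarrow> real measure \<Rightarrow> bool" where
  "hill_horror \<alpha> D \<longleftrightarrow>
     real_distribution D \<and> measure D {0<..} = 1 \<and>
     (\<forall>p\<in>{0<..<1}. quantile (cdf D) p = hh_quantile (1 / \<alpha>) p)"

text \<open>
  The \<open>k\<close>-th smallest of \<open>x 1, \<dots>, x n\<close>; meaningful for \<open>1 \<le> k \<le> n\<close>. Samples are indexed from 1.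
\<close>

definition order_stat :: "nat \<Rightarrow> nat \<Rightarrow> (nat \<Rightarrow> real) \<Rightarrow> real" where
  "order_stat k n x = sort (map x [1..<Suc n]) ! (k - 1)"

definition hh_Q :: "nat \<Rightarrow> nat \<Rightarrow> (nat \<Rightarrow> real) \<Rightarrow> real" where
  "hh_Q i s x =
     (let n = i * (s + 1) - 1 in
       (ln (order_stat (i * s) n x / order_stat i n x)
         + ln (1 - ln (real s) / ln (real s + 1))) / ln (real s))"

definition hh_quantile_est :: "nat \<Rightarrow> nat \<Rightarrow> (nat \<Rightarrow> real) \<Rightarrow> real \<Rightarrow> real" where
  "hh_quantile_est i s x p = hh_quantile (hh_Q i s x) p"

end

theory Submission
  imports Defs
begin

text \<open>
  By Hoeffding's inequality and the Borel-Cantelli lemma, the empirical distribution function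
  converges almost surely to \<open>F\<close> at all rational points simultaneously. Where the quantile function
  is continuous, this forces the order statistics of rank \<open>k\<close> with \<open>k / n \<rightarrow> p\<close> to converge to the
  \<open>p\<close>-quantile. The ranks \<open>i\<close> and \<open>i * s\<close> correspond to the levels \<open>1 / (s + 1)\<close> and
  \<open>s / (s + 1)\<close>; the ratio of the two Hill-horror quantiles is
  \<open>s powr (1 / \<alpha>) / (1 - ln s / ln (s + 1))\<close>, whose second factor is what the estimator corrects for.
\<close>

section \<open>Order statistics\<close>

text \<open>In a sorted list the entries that are at most \<open>t\<close> occupy an initial segment
  of indices. The offset \<open>k - 1\<close> is due to ranks starting at 1 and list indices at
  0.\<close>

lemma sorted_nth_le_iff:
  fixes ys :: "'a::linorder list"
  assumes "sorted ys" "1 \<le> k" "k \<le> length ys"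
  shows "ys ! (k - 1) \<le> t \<longleftrightarrow> k \<le> card {j. j < length ys \<and> ys ! j \<le> t}"
proof
  assume le: "ys ! (k - 1) \<le> t"
  have "ys ! j \<le> t" if "j < k" for j
    by (rule order_trans[OF sorted_nth_mono[OF assms(1)] le]) (use that assms in auto)
  then have "{..<k} \<subseteq> {j. j < length ys \<and> ys ! j \<le> t}"
    using assms by auto
  then show "k \<le> card {j. j < length ys \<and> ys ! j \<le> t}"
    using card_mono[of "{j. j < length ys \<and> ys ! j \<le> t}" "{..<k}"] by simp
next
  assume k: "k \<le> card {j. j < length ys \<and> ys ! j \<le> t}"
  show "ys ! (k - 1) \<le> t"
  proof (rule ccontr)
    assume gt: "\<not> ys ! (k - 1) \<le> t"
    have "j < k - 1" if "j < length ys" "ys ! j \<le> t" for j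
      using sorted_nth_mono[OF assms(1), of "k - 1" j] that gt by force
    then have "{j. j < length ys \<and> ys ! j \<le> t} \<subseteq> {..<k - 1}"
      by auto
    then have "card {j. j < length ys \<and> ys ! j \<le> t} \<le> k - 1"
      using card_mono[of "{..<k - 1}"] by fastforce
    with k assms show False by simp
  qed
qed

text \<open>Sorting only permutes the sample, so it does not change how many values are at most
  \<open>t\<close>. This turns order statistics into counts, hence into the empirical distribution
  function.\<close>

lemma order_stat_le_iff:
  assumes "1 \<le> k" "k \<le> n"
  shows "order_stat k n x \<le> t \<longleftrightarrow> k \<le> card {j \<in> {1..n}. x j \<le> t}"
proof -
  let ?xs = "map x [1..<Suc n]"
  have "card {j. j < length (sort ?xs) \<and> sort ?xs ! j \<le> t} = length (filter (\<lambda>y. y \<le> t) (sort ?xs))"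
    by (simp add: length_filter_conv_card)
  also have "\<dots> = length (filter (\<lambda>y. y \<le> t) ?xs)"
    by (simp only: filter_sort length_sort)
  also have "\<dots> = length (filter (\<lambda>j. x j \<le> t) [1..<Suc n])"
    by (simp only: filter_map length_map comp_def)
  also have "\<dots> = card (set (filter (\<lambda>j. x j \<le> t) [1..<Suc n]))"
    by (rule distinct_card[symmetric]) (simp only: distinct_filter distinct_upt)
  also have "set (filter (\<lambda>j. x j \<le> t) [1..<Suc n]) = {j \<in> {1..n}. x j \<le> t}"
    by (auto simp del: upt_Suc)
  finally show ?thesis
    unfolding order_stat_def using sorted_nth_le_iff[of "sort ?xs" k t] assms
    by (simp del: upt_Suc)
qed

text \<open>This is the deterministic core, applied to one sample path at a time. The strict
  inequalities on both sides of \<open>q\<close> let the limiting rank \<open>p\<close> be separated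
  from \<open>F t\<close>. Rational \<open>t\<close> are dense enough to squeeze the order
  statistic, and being countable they cost only one null set later.\<close>

lemma order_stat_tendsto:
  fixes F x :: "_ \<Rightarrow> real" and k N :: "nat \<Rightarrow> nat" and p q :: real
  assumes below: "\<And>t. t < q \<Longrightarrow> F t < p"
    and above: "\<And>t. q < t \<Longrightarrow> p < F t"
    and freq: "\<And>t. t \<in> \<rat> \<Longrightarrow> (\<lambda>n. card {j \<in> {1..n}. x j \<le> t} / n) \<longlonglongrightarrow> F t"
    and N: "filterlim N at_top sequentially"
    and k: "(\<lambda>i. k i / N i) \<longlonglongrightarrow> p"
    and range: "\<forall>\<^sub>F i in sequentially. 1 \<le> k i \<and> k i \<le> N i"
  shows "(\<lambda>i. order_stat (k i) (N i) x) \<longlonglongrightarrow> q"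
proof (rule order_tendstoI)
  \<comment> \<open>The sign of this difference tells whether the rank \<open>k i\<close> exceeds
    the number of sample values up to \<open>t\<close>.\<close>
  have diff: "(\<lambda>i. k i / N i - card {j \<in> {1..N i}. x j \<le> t} / N i) \<longlonglongrightarrow> p - F t"
    if "t \<in> \<rat>" for t
    by (intro tendsto_diff k filterlim_compose[OF freq N] that)
  {
    fix a assume "a < q"
    then obtain t where t: "t \<in> \<rat>" "a < t" "t < q"
      using Rats_dense_in_real by blast
    have "\<forall>\<^sub>F i in sequentially. 0 < k i / N i - card {j \<in> {1..N i}. x j \<le> t} / N i"
      using order_tendstoD(1)[OF diff[OF t(1)], of 0] below[OF t(3)] by simp
    with range show "\<forall>\<^sub>F i in sequentially. a < order_stat (k i) (N i) x"
    proof eventually_elim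
      case (elim i)
      then have "card {j \<in> {1..N i}. x j \<le> t} < k i"
        by (simp add: field_simps)
      then show ?case
        using order_stat_le_iff[of "k i" "N i" x t] elim t(2) by auto
    qed
  }
  {
    fix b assume "q < b"
    then obtain t where t: "t \<in> \<rat>" "q < t" "t < b"
      using Rats_dense_in_real by blast
    have "\<forall>\<^sub>F i in sequentially. k i / N i - card {j \<in> {1..N i}. x j \<le> t} / N i < 0"
      using order_tendstoD(2)[OF diff[OF t(1)], of 0] above[OF t(2)] by simp
    with range show "\<forall>\<^sub>F i in sequentially. order_stat (k i) (N i) x < b"
    proof eventually_elim
      case (elim i)
      then have "k i \<le> card {j \<in> {1..N i}. x j \<le> t}"
        by (simp add: field_simps)
      then show ?case
        using order_stat_le_iff[of "k i" "N i" x t] elim t(3) by auto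
    qed
  }
qed

section \<open>Almost sure convergence of the empirical distribution function\<close>

text \<open>Boundedness makes Hoeffding's bound on a deviation of size \<open>e\<close> geometric in
  \<open>n\<close>, hence summable, so Borel-Cantelli applies.\<close>

lemma (in prob_space) bounded_iid_strong_law:
  fixes Z :: "nat \<Rightarrow> 'a \<Rightarrow> real"
  assumes indep: "indep_vars (\<lambda>_. borel) Z {1..}"
    and distr: "\<And>j. 1 \<le> j \<Longrightarrow> distr M borel (Z j) = distr M borel (Z 1)"
    and AE_bounded: "AE \<omega> in M. Z 1 \<omega> \<in> {a..b}" and "a < b"
  shows "AE \<omega> in M. (\<lambda>n. (\<Sum>j=1..n. Z j \<omega>) / n) \<longlonglongrightarrow> expectation (Z 1)"
proof -
  have [measurable]: "random_variable borel (Z j)" if "1 \<le> j" for j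
    using indep that unfolding indep_vars_def by auto
  define \<mu> where "\<mu> = expectation (Z 1)"
  define A where "A e n = {\<omega> \<in> space M. \<bar>(\<Sum>j=1..n. Z j \<omega>) / n - \<mu>\<bar> \<ge> e}" for e and n :: nat
  have A_meas: "A e n \<in> sets M" for e n
    unfolding A_def by measurable
  have bound: "prob (A e n) \<le> 2 * exp (- 2 * e\<^sup>2 / (b - a)\<^sup>2) ^ n" if "e > 0" for e n
  \<comment> \<open>Hoeffding's inequality is used for nonempty samples only; for
    \<open>n = 0\<close> the claimed bound is 2, which is trivial.\<close>
  proof (cases "n = 0")
    case False
    interpret H: Hoeffding_ineq_iid M "{1..n}" Z "Z 1" a b \<mu>
    proof unfold_locales
      show "indep_vars (\<lambda>_. borel) Z {1..n}"
        by (rule indep_vars_subset[OF indep]) auto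
      show "distr M borel (Z j) = distr M borel (Z 1)" if "j \<in> {1..n}" for j
        by (rule distr) (use that in simp)
    qed (use AE_bounded in \<open>simp_all add: \<mu>_def\<close>)
    show ?thesis
      using H.Hoeffding_ineq_abs_ge'[of e] that False \<open>a < b\<close>
      by (simp add: A_def exp_of_nat_mult[symmetric] mult_ac)
  qed (use order_trans[OF prob_le_1[of "A e 0"], of 2] in simp)
  have summable: "summable (\<lambda>n. prob (A e n))" if "e > 0" for e
  proof (rule summable_comparison_test')
    show "summable (\<lambda>n. 2 * exp (- 2 * e\<^sup>2 / (b - a)\<^sup>2) ^ n)"
      using that \<open>a < b\<close> by (intro summable_mult summable_geometric) (simp add: divide_neg_pos)
    show "norm (prob (A e n)) \<le> 2 * exp (- 2 * e\<^sup>2 / (b - a)\<^sup>2) ^ n" if "n \<ge> 0" for n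
      using bound[OF \<open>e > 0\<close>] by simp
  qed
  \<comment> \<open>The thresholds \<open>1 / Suc m\<close> suffice for every \<open>e > 0\<close>,
    and countably many almost sure events hold simultaneously.\<close>
  have "AE \<omega> in M. \<forall>m. \<forall>\<^sub>F n in sequentially. \<omega> \<in> space M - A (1 / Suc m) n"
    unfolding AE_all_countable
    by (intro allI borel_cantelli_AE1 A_meas summable) (auto simp: less_top[symmetric])
  then show ?thesis
    unfolding \<mu>_def[symmetric]
  proof eventually_elim
    case (elim \<omega>)
    show ?case
    proof (rule tendstoI)
      fix e :: real assume "e > 0"
      then obtain m where "1 / Suc m < e"
        using nat_approx_posE by blast
      with elim[rule_format, of m]
      show "\<forall>\<^sub>F n in sequentially. dist ((\<Sum>j=1..n. Z j \<omega>) / n) \<mu> < e"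
        by (auto elim!: eventually_mono simp: A_def dist_real_def)
    qed
  qed
qed

text \<open>For fixed \<open>t\<close>, the empirical frequency is the mean of i.i.d. indicators
  with values in [0, 1] and expectation \<open>cdf D t\<close>.\<close>

lemma (in prob_space) AE_empirical_cdf_tendsto:
  fixes X :: "nat \<Rightarrow> 'a \<Rightarrow> real"
  assumes indep: "indep_vars (\<lambda>_. borel) X {1..}"
    and distr: "\<And>j. 1 \<le> j \<Longrightarrow> distr M borel (X j) = D"
  shows "AE \<omega> in M. \<forall>t\<in>\<rat>. (\<lambda>n. card {j \<in> {1..n}. X j \<omega> \<le> t} / n) \<longlonglongrightarrow> cdf D t"
proof (subst AE_ball_countable[OF countable_rat], rule ballI)
  fix t :: real
  define Z where "Z j = (\<lambda>\<omega>. indicator {..t} (X j \<omega>) :: real)" for j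
  have X [measurable]: "random_variable borel (X j)" if "1 \<le> j" for j
    using indep that unfolding indep_vars_def by auto
  have "AE \<omega> in M. (\<lambda>n. (\<Sum>j=1..n. Z j \<omega>) / n) \<longlonglongrightarrow> expectation (Z 1)"
  proof (rule bounded_iid_strong_law[where a = 0 and b = 1])
    show "indep_vars (\<lambda>_. borel) Z {1..}"
      unfolding Z_def by (rule indep_vars_compose2[OF indep]) auto
    show "distr M borel (Z j) = distr M borel (Z 1)" if "1 \<le> j" for j
    proof -
      have "distr M borel (Z i) = distr D borel (indicator {..t})" if "1 \<le> i" for i
        unfolding Z_def distr[OF that, symmetric] using that
        by (subst distr_distr) (auto simp: comp_def)
      then show ?thesis using that by simp
    qed
  qed (auto simp: Z_def indicator_def)
  moreover have "expectation (Z 1) = cdf D t"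
  proof -
    have "expectation (Z 1) = expectation (indicator (X 1 -` {..t} \<inter> space M))"
      by (rule Bochner_Integration.integral_cong) (auto simp: Z_def indicator_def)
    also have "\<dots> = measure M (X 1 -` {..t} \<inter> space M)"
      by simp
    also have "\<dots> = cdf D t"
      unfolding cdf_def distr[of 1, OF order.refl, symmetric] by (subst measure_distr) auto
    finally show ?thesis .
  qed
  moreover have "(\<Sum>j=1..n. Z j \<omega>) = card {j \<in> {1..n}. X j \<omega> \<le> t}" for n \<omega>
    by (simp add: Z_def indicator_def sum.If_cases Int_def)
  ultimately show "AE \<omega> in M. (\<lambda>n. card {j \<in> {1..n}. X j \<omega> \<le> t} / n) \<longlonglongrightarrow> cdf D t"
    by simp
qed

section \<open>Quantiles\<close>

context real_distribution
begin

lemma cdf_less_if_less_quantile: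
  assumes "0 < p" "t < quantile (cdf M) p"
  shows "cdf M t < p"
proof (rule ccontr)
  assume "\<not> cdf M t < p"
  obtain l where l: "\<And>y. y \<le> l \<Longrightarrow> cdf M y < p"
    using order_tendstoD(2)[OF cdf_lim_at_bot assms(1)] by (auto simp: eventually_at_bot_linorder)
  \<comment> \<open>The cdf tends to 0 at minus infinity, so it stays below \<open>p > 0\<close>
    left of \<open>l\<close>. Without a lower bound, \<open>Inf\<close> over the reals would say
    nothing.\<close>
  have "bdd_below {x. p \<le> cdf M x}"
    using l by (intro bdd_belowI[of _ l]) (metis linorder_not_le mem_Collect_eq nle_le)
  then have "quantile (cdf M) p \<le> t"
    unfolding quantile_def using \<open>\<not> cdf M t < p\<close> by (intro cInf_lower) auto
  with assms show False by simp
qed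

lemma le_cdf_if_quantile_less:
  assumes "p < 1" "quantile (cdf M) p < t"
  shows "p \<le> cdf M t"
proof -
  obtain u where "\<And>y. u \<le> y \<Longrightarrow> p < cdf M y"
    using order_tendstoD(1)[OF cdf_lim_at_top_prob assms(1)] by (auto simp: eventually_at_top_linorder)
  then have "{x. p \<le> cdf M x} \<noteq> {}"
    by (metis empty_Collect_eq less_imp_le order.refl)
  then obtain x where "p \<le> cdf M x" "x < t"
    using cInf_lessD[of "{x. p \<le> cdf M x}" t] assms(2) unfolding quantile_def by auto
  then show ?thesis
    using cdf_nondecreasing[of x t] by simp
qed

text \<open>If the cdf had a flat piece at height \<open>p\<close>, only the weak inequality would
  hold. Continuity of the quantile function excludes this: some \<open>r > p\<close> still has its
  quantile below \<open>t\<close>, so \<open>p < r \<le> cdf M t\<close>.\<close>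

lemma less_cdf_if_quantile_less:
  assumes "p < 1" "quantile (cdf M) p < t" "isCont (quantile (cdf M)) p"
  shows "p < cdf M t"
proof -
  have "\<forall>\<^sub>F r in at_right p. quantile (cdf M) r < t"
    using assms(2,3) order_tendstoD(2) filterlim_at_split unfolding isCont_def by blast
  moreover have "\<forall>\<^sub>F r in at_right p. r \<in> {p<..<1}"
    using assms(1) by (rule eventually_at_right_real)
  ultimately have "\<forall>\<^sub>F r in at_right p. quantile (cdf M) r < t \<and> r \<in> {p<..<1}"
    by (rule eventually_conj)
  then obtain r where "quantile (cdf M) r < t" "p < r" "r < 1"
    using eventually_happens'[of "at_right p"] by fastforce
  then show ?thesis
    using le_cdf_if_quantile_less[of r t] by simp
qed

end

section \<open>The Hill-horror quantile function\<close>

lemma isCont_hh_quantile: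
  assumes "p < 1"
  shows "isCont (hh_quantile \<gamma>) p"
  unfolding hh_quantile_def using assms by (intro continuous_intros) auto

lemma hh_quantile_pos:
  assumes "0 < p" "p < 1"
  shows "0 < hh_quantile \<gamma> p"
  unfolding hh_quantile_def using assms by (intro divide_pos_pos) auto

lemma ln_hh_quantile:
  assumes "0 < p" "p < 1"
  shows "ln (hh_quantile \<gamma> p) = ln (- ln (1 - p)) - \<gamma> * ln (1 - p)"
  unfolding hh_quantile_def using assms by (subst ln_div) (auto simp: ln_powr)

text \<open>The power factors contribute \<open>\<gamma> * ln s\<close>. The logarithmic factors
  contribute \<open>ln (ln (s + 1)) - ln (ln (s + 1) - ln s)\<close>, which the correction term
  cancels exactly.\<close>

lemma ln_hh_quantile_ratio:
  assumes "s > (1 :: real)"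
  shows "ln (hh_quantile \<gamma> (s / (s + 1)) / hh_quantile \<gamma> (1 / (s + 1)))
           + ln (1 - ln s / ln (s + 1)) = \<gamma> * ln s"
proof -
  \<comment> \<open>The two levels are complementary, so each \<open>1 - p\<close> is the other
    level.\<close>
  have compl: "1 - s / (s + 1) = 1 / (s + 1)" "1 - 1 / (s + 1) = s / (s + 1)"
    using assms by (auto simp: field_simps)
  have ln_s: "0 < ln s" "ln s < ln (s + 1)"
    using assms by auto
  have hi: "ln (hh_quantile \<gamma> (s / (s + 1))) = ln (ln (s + 1)) + \<gamma> * ln (s + 1)"
    using assms by (subst ln_hh_quantile) (auto simp: compl ln_div)
  have lo: "ln (hh_quantile \<gamma> (1 / (s + 1))) = ln (ln (s + 1) - ln s) - \<gamma> * (ln s - ln (s + 1))"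
    using assms by (subst ln_hh_quantile) (auto simp: compl ln_div)
  have "1 - ln s / ln (s + 1) = (ln (s + 1) - ln s) / ln (s + 1)"
    using ln_s by (simp add: diff_divide_distrib)
  then have "ln (1 - ln s / ln (s + 1)) = ln (ln (s + 1) - ln s) - ln (ln (s + 1))"
    using ln_s by (simp add: ln_div)
  moreover have "ln (hh_quantile \<gamma> (s / (s + 1)) / hh_quantile \<gamma> (1 / (s + 1)))
      = ln (hh_quantile \<gamma> (s / (s + 1))) - ln (hh_quantile \<gamma> (1 / (s + 1)))"
    using hh_quantile_pos[of "s / (s + 1)" \<gamma>] hh_quantile_pos[of "1 / (s + 1)" \<gamma>] assms
    by (simp add: ln_div)
  ultimately show ?thesis
    unfolding hi lo by (simp add: algebra_simps)
qed

lemma isCont_hill_horror_quantile: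
  assumes "hill_horror \<alpha> D" "0 < p" "p < 1"
  shows "isCont (quantile (cdf D)) p"
proof -
  \<comment> \<open>The quantile function is prescribed only on the open unit interval, but
    continuity at \<open>p\<close> depends only on values near \<open>p\<close>.\<close>
  have "\<forall>\<^sub>F r in nhds p. r \<in> {0<..<1}"
    using assms by (intro eventually_nhds_in_open) auto
  then have "\<forall>\<^sub>F r in nhds p. quantile (cdf D) r = hh_quantile (1 / \<alpha>) r"
    using assms(1) by (auto elim!: eventually_mono simp: hill_horror_def)
  then show ?thesis
    using isCont_cong isCont_hh_quantile[OF assms(3)] by blast
qed

section \<open>Limits of the order statistics and of the estimators\<close>

lemma AE_hill_horror_order_stat_tendsto:
  fixes X :: "nat \<Rightarrow> 'a \<Rightarrow> real"
  assumes "prob_space M" "hill_horror \<alpha> D"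
    and indep: "prob_space.indep_vars M (\<lambda>_. borel) X {1..}"
    and distr: "\<And>j. j \<ge> 1 \<Longrightarrow> distr M borel (X j) = D"
    and p: "0 < p" "p < 1"
    and N: "filterlim N at_top sequentially"
    and k: "(\<lambda>i. k i / N i) \<longlonglongrightarrow> p"
    and range: "\<forall>\<^sub>F i in sequentially. 1 \<le> k i \<and> k i \<le> N i"
  shows "AE \<omega> in M. (\<lambda>i. order_stat (k i) (N i) (\<lambda>j. X j \<omega>)) \<longlonglongrightarrow> hh_quantile (1 / \<alpha>) p"
proof -
  interpret prob_space M by fact
  interpret D: real_distribution D using assms(2) by (simp add: hill_horror_def)
  have q: "quantile (cdf D) p = hh_quantile (1 / \<alpha>) p"
    using assms(2) p by (simp add: hill_horror_def)
  have "AE \<omega> in M. \<forall>t\<in>\<rat>. (\<lambda>n. card {j \<in> {1..n}. X j \<omega> \<le> t} / n) \<longlonglongrightarrow> cdf D t"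
    using indep distr by (rule AE_empirical_cdf_tendsto)
  then show ?thesis
  proof eventually_elim
    case (elim \<omega>)
    show ?case
    proof (rule order_stat_tendsto[OF _ _ _ N k range])
      show "cdf D t < p" if "t < hh_quantile (1 / \<alpha>) p" for t
        using D.cdf_less_if_less_quantile that p q by simp
      show "p < cdf D t" if "hh_quantile (1 / \<alpha>) p < t" for t
        using D.less_cdf_if_quantile_less isCont_hill_horror_quantile[OF assms(2)] that p q by simp
    qed (use elim in blast)
  qed
qed

lemma hh_Q_tendsto:
  assumes s: "s \<ge> 2"
    and hi: "(\<lambda>i. order_stat (i * s) (i * (s + 1) - 1) x) \<longlonglongrightarrow> hh_quantile \<gamma> (real s / (real s + 1))"
    and lo: "(\<lambda>i. order_stat i (i * (s + 1) - 1) x) \<longlonglongrightarrow> hh_quantile \<gamma> (1 / (real s + 1))"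
  shows "(\<lambda>i. hh_Q i s x) \<longlonglongrightarrow> \<gamma>"
proof -
  define u v where "u = hh_quantile \<gamma> (real s / (real s + 1))" and "v = hh_quantile \<gamma> (1 / (real s + 1))"
  \<comment> \<open>Positive limits make both the quotient and its logarithm continuous at the limit
    point.\<close>
  have pos: "0 < u" "0 < v"
    unfolding u_def v_def using s by (auto intro!: hh_quantile_pos)
  have "(\<lambda>i. ln (order_stat (i * s) (i * (s + 1) - 1) x / order_stat i (i * (s + 1) - 1) x))
      \<longlonglongrightarrow> ln (u / v)"
    using pos by (intro tendsto_ln tendsto_divide hi[folded u_def] lo[folded v_def]) auto
  then have "(\<lambda>i. hh_Q i s x) \<longlonglongrightarrow> (ln (u / v) + ln (1 - ln (real s) / ln (real s + 1))) / ln (real s)"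
    unfolding hh_Q_def Let_def by (rule tendsto_divide[OF tendsto_add[OF _ tendsto_const] tendsto_const])
      (use s in auto)
  also have "ln (u / v) + ln (1 - ln (real s) / ln (real s + 1)) = \<gamma> * ln (real s)"
    unfolding u_def v_def by (rule ln_hh_quantile_ratio) (use s in auto)
  also have "\<gamma> * ln (real s) / ln (real s) = \<gamma>"
    using s by simp
  finally show ?thesis .
qed

theorem theorem6:
  fixes M :: "'a measure" and X :: "nat \<Rightarrow> 'a \<Rightarrow> real" and D :: "real measure"
    and s :: nat and p \<alpha> :: real
  assumes "prob_space M"
    and "s \<ge> 2" and "0 < p" and "p < 1" and "\<alpha> > 0"
    and "hill_horror \<alpha> D"
    and "prob_space.indep_vars M (\<lambda>_. borel) X {1..}"
    and "\<And>j. j \<ge> 1 \<Longrightarrow> distr M borel (X j) = D"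
  shows "(AE \<omega> in M. (\<lambda>i. hh_Q i s (\<lambda>j. X j \<omega>)) \<longlonglongrightarrow> 1 / \<alpha>) \<and>
         (AE \<omega> in M. (\<lambda>i. hh_quantile_est i s (\<lambda>j. X j \<omega>) p) \<longlonglongrightarrow> quantile (cdf D) p)"
proof -
  note order_stat_lim =
    AE_hill_horror_order_stat_tendsto[OF assms(1,6,7,8), where N = "\<lambda>i. i * (s + 1) - 1"]
  have N_ge: "i * s \<le> i * (s + 1) - 1" "i \<le> i * s" "i \<le> i * (s + 1) - 1" if "1 \<le> i" for i
  proof -
    show "i * s \<le> i * (s + 1) - 1" using that by (simp add: algebra_simps)
    moreover show "i \<le> i * s" using assms(2) by simp
    ultimately show "i \<le> i * (s + 1) - 1" by linarith
  qed
  have N: "filterlim (\<lambda>i. i * (s + 1) - 1) at_top sequentially"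
    by (rule filterlim_at_top_mono[OF filterlim_ident])
      (use N_ge(3) in \<open>auto simp: eventually_sequentially\<close>)
  \<comment> \<open>The choices \<open>c = s\<close> and \<open>c = 1\<close> give the limiting
    levels of the upper and lower rank.\<close>
  have N_lim: "(\<lambda>i. real (i * c) / real (i * (s + 1) - 1)) \<longlonglongrightarrow> c / (real s + 1)" for c
  proof (rule Lim_transform_eventually)
    have "(\<lambda>i. c / (real s + 1 - 1 / real i)) \<longlonglongrightarrow> c / (real s + 1 - 0)"
      by (intro tendsto_divide tendsto_diff tendsto_const lim_1_over_n) auto
    then show "(\<lambda>i. c / (real s + 1 - 1 / real i)) \<longlonglongrightarrow> c / (real s + 1)" by simp
    show "\<forall>\<^sub>F i in sequentially.
        c / (real s + 1 - 1 / real i) = real (i * c) / real (i * (s + 1) - 1)"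
      \<comment> \<open>For \<open>i \<ge> 1\<close> the natural-number subtraction does not
        truncate, and \<open>i\<close> can be cancelled.\<close>
      using eventually_ge_at_top[of 1]
    proof eventually_elim
      case (elim i)
      then have "real (i * (s + 1) - 1) = i * (real s + 1 - 1 / i)"
        by (subst of_nat_diff) (auto simp: algebra_simps)
      then show ?case using elim by simp
    qed
  qed
  have hi: "AE \<omega> in M. (\<lambda>i. order_stat (i * s) (i * (s + 1) - 1) (\<lambda>j. X j \<omega>))
      \<longlonglongrightarrow> hh_quantile (1 / \<alpha>) (real s / (real s + 1))"
  proof (rule order_stat_lim[OF _ _ _ N N_lim])
    show "\<forall>\<^sub>F i in sequentially. 1 \<le> i * s \<and> i * s \<le> i * (s + 1) - 1"
      using eventually_ge_at_top[of 1] by eventually_elim (use N_ge le_trans in blast)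
  qed (use assms in auto)
  have lo: "AE \<omega> in M. (\<lambda>i. order_stat i (i * (s + 1) - 1) (\<lambda>j. X j \<omega>))
      \<longlonglongrightarrow> hh_quantile (1 / \<alpha>) (1 / (real s + 1))"
  proof (rule order_stat_lim[OF _ _ _ N])
    show "(\<lambda>i. real i / real (i * (s + 1) - 1)) \<longlonglongrightarrow> 1 / (real s + 1)"
      using N_lim[of 1] by simp
    show "\<forall>\<^sub>F i in sequentially. 1 \<le> i \<and> i \<le> i * (s + 1) - 1"
      using eventually_ge_at_top[of 1] by eventually_elim (use N_ge in blast)
  qed (use assms in auto)
  have Q: "AE \<omega> in M. (\<lambda>i. hh_Q i s (\<lambda>j. X j \<omega>)) \<longlonglongrightarrow> 1 / \<alpha>"
    using hi lo by eventually_elim (rule hh_Q_tendsto[OF assms(2)])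
  moreover have "AE \<omega> in M. (\<lambda>i. hh_quantile_est i s (\<lambda>j. X j \<omega>) p) \<longlonglongrightarrow> quantile (cdf D) p"
    using Q
  proof eventually_elim
    case (elim \<omega>)
    \<comment> \<open>Only the exponent is random, and a power with the fixed base
      \<open>1 - p > 0\<close> is continuous in its exponent.\<close>
    then have "(\<lambda>i. hh_quantile_est i s (\<lambda>j. X j \<omega>) p) \<longlonglongrightarrow> hh_quantile (1 / \<alpha>) p"
      unfolding hh_quantile_est_def hh_quantile_def using assms(4) by (intro tendsto_intros) auto
    then show ?case
      using assms(3,4,6) by (simp add: hill_horror_def)
  qed
  ultimately show ?thesis ..
qed

end
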